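(* Let $G$ be a graph and $w: V(G)\to[0,\infty)$ a rational vertex weighting. Then $\chi^w_f(G) \leq \rho_w(G)$.
   Context: All numbers are rational. A fractional $k\wr w$-colouring of $G$ is an assignment of nonnegative weights to the stable sets of $G$ with total weight $k$ such that for every vertex $v$ the total weight of stable sets containing $v$ is at least $w(v)$; $\chi_f^w(G)$ is the minimum $k$ for which such a colouring exists. For a vertex $v$, let $\tilde N(v)$ be its closed neighbourhood. The degree weight is $w_d(v)=\sum_{u\in\tilde N(v)} w(u)$; the clique weight $w_c(v)$ is the maximum over all cliques $C$ containing $v$ of $\sum_{u\in C}w(u)$; the Reed weight is $\rho_w(v)=\tfrac12(w_d(v)+w_c(v))$, and $\rho_w(G)=\max_{v\in V(G)}\rho_w(v)$. *)

theory Defs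
  imports Complex_Main "Graph_Theory.Pair_Digraph"
begin

text \<open>
  Finite simple graphs are represented by the locale \<^locale>\<open>pair_graph\<close>: a finite vertex set
  with a symmetric, loop-free arc relation, where an undirected edge \<open>uv\<close> is the pair of arcs
  \<open>(u, v)\<close>, \<open>(v, u)\<close>.  All weights are rational.
\<close>

definition stable_sets :: "'a pair_pre_digraph \<Rightarrow> 'a set set" where
  "stable_sets G = {S. S \<subseteq> pverts G \<and> (\<forall>u\<in>S. \<forall>v\<in>S. (u, v) \<notin> parcs G)}"

definition cliques :: "'a pair_pre_digraph \<Rightarrow> 'a set set" where
  "cliques G = {C. C \<subseteq> pverts G \<and> (\<forall>u\<in>C. \<forall>v\<in>C. u \<noteq> v \<longrightarrow> (u, v) \<in> parcs G)}"

definition closed_nbhd :: "'a pair_pre_digraph \<Rightarrow> 'a \<Rightarrow> 'a set" where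
  "closed_nbhd G v = insert v {u. (v, u) \<in> parcs G}"

definition frac_colouring ::
    "'a pair_pre_digraph \<Rightarrow> ('a \<Rightarrow> rat) \<Rightarrow> rat \<Rightarrow> ('a set \<Rightarrow> rat) \<Rightarrow> bool" where
  "frac_colouring G w k y \<longleftrightarrow>
     (\<forall>S\<in>stable_sets G. 0 \<le> y S) \<and>
     (\<Sum>S\<in>stable_sets G. y S) = k \<and>
     (\<forall>v\<in>pverts G. w v \<le> (\<Sum>S | S \<in> stable_sets G \<and> v \<in> S. y S))"

text \<open>
  \<^const>\<open>Least\<close> on a type that is not well-ordered is determined only if the minimum is attained;
  for a finite graph it is, being the value of a feasible, bounded rational linear program.
\<close>

definition frac_chromatic :: "'a pair_pre_digraph \<Rightarrow> ('a \<Rightarrow> rat) \<Rightarrow> rat" where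
  "frac_chromatic G w = (LEAST k. \<exists>y. frac_colouring G w k y)"

definition degree_weight :: "'a pair_pre_digraph \<Rightarrow> ('a \<Rightarrow> rat) \<Rightarrow> 'a \<Rightarrow> rat" where
  "degree_weight G w v = (\<Sum>u\<in>closed_nbhd G v. w u)"

definition clique_weight :: "'a pair_pre_digraph \<Rightarrow> ('a \<Rightarrow> rat) \<Rightarrow> 'a \<Rightarrow> rat" where
  "clique_weight G w v = Max ((\<lambda>C. \<Sum>u\<in>C. w u) ` {C \<in> cliques G. v \<in> C})"

definition reed_weight_at :: "'a pair_pre_digraph \<Rightarrow> ('a \<Rightarrow> rat) \<Rightarrow> 'a \<Rightarrow> rat" where
  "reed_weight_at G w v = 1 / 2 * (degree_weight G w v + clique_weight G w v)"

text \<open>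
  The maximum over the vertices of the graph without vertices is taken to be 0; the value of
  \<^const>\<open>Max\<close> on the empty set is unspecified.
\<close>

definition reed_weight :: "'a pair_pre_digraph \<Rightarrow> ('a \<Rightarrow> rat) \<Rightarrow> rat" where
  "reed_weight G w = (if pverts G = {} then 0 else Max (reed_weight_at G w ` pverts G))"

end

theory Submission
  imports Defs
begin

text \<open>
  Pick \<open>S\<close> among the stable sets of maximum cardinality of an induced subgraph \<open>H\<close>, with
  probability proportional to \<open>\<Prod>u\<in>S. w u\<close>; this is the uniform choice of a maximum stable set
  after replacing each vertex \<open>u\<close> by a clique of size \<open>w u\<close>.  Every such \<open>S\<close> meets the closed
  neighbourhood of a vertex \<open>v\<close> of \<open>H\<close>, and exchanging a unique common element for \<open>v\<close> bounds the
  probability that there is only one by \<open>w\<^sub>c(v) / w(v)\<close> times the probability of \<open>v \<in> S\<close>.  Hence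
  the expected size of the intersection plus \<open>w\<^sub>c(v) / w(v) \<cdot> Pr(v \<in> S)\<close> is at least 2.
  Use these distributions to cover the demand \<open>w\<close>, shrinking \<open>H\<close> whenever the residual demand of
  a vertex vanishes.  Adding up the inequality over all steps for a vertex \<open>v\<close> that survives to the
  last step, twice the total weight is at most \<open>w\<^sub>d(v) + w\<^sub>c(v)\<close>.

  That the minimum defining the fractional chromatic number is attained over the rationals follows
  by Fourier--Motzkin elimination of all the variables except the total weight.
\<close>

section \<open>Fourier--Motzkin elimination and attained minima\<close>

text \<open>A triple \<open>(a, b, c)\<close> is the affine form with coefficients \<open>a\<close>
  in the variables \<open>y\<close>, slope \<open>b\<close> in \<open>k\<close> and constant
  \<open>c\<close>; \<open>k\<close> is kept apart because it is never eliminated.\<close>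

definition affine_value ::
    "'i set \<Rightarrow> ('i \<Rightarrow> 'f) \<Rightarrow> 'f \<Rightarrow> ('i \<Rightarrow> 'f) \<times> 'f \<times> 'f \<Rightarrow> 'f::linordered_field" where
  "affine_value I y k \<phi> = (\<Sum>i\<in>I. fst \<phi> i * y i) + fst (snd \<phi>) * k + snd (snd \<phi>)"

lemma between_finite_sets:
  fixes L U :: "'a::linorder set"
  assumes "finite L" "finite U" "\<And>l u. l \<in> L \<Longrightarrow> u \<in> U \<Longrightarrow> l \<le> u"
  shows "\<exists>x. (\<forall>l\<in>L. l \<le> x) \<and> (\<forall>u\<in>U. x \<le> u)"
proof (cases "L = {}")
  case True
  show ?thesis
  proof (cases "U = {}")
    case False
    then show ?thesis using True assms by (intro exI[of _ "Min U"]) auto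
  qed (use True in auto)
next
  case False
  then show ?thesis using assms by (intro exI[of _ "Max L"]) auto
qed

text \<open>Eliminating one variable pairs each lower bound on it with each upper bound; by
  induction a finite system in \<open>k\<close> alone remains.\<close>

lemma fourier_motzkin:
  fixes C :: "(('i \<Rightarrow> 'f::linordered_field) \<times> 'f \<times> 'f) set"
  assumes "finite I" "finite C"
  shows "\<exists>D. finite D \<and>
    (\<forall>k. (\<exists>y. \<forall>\<phi>\<in>C. 0 \<le> affine_value I y k \<phi>) \<longleftrightarrow> (\<forall>(b, c)\<in>D. 0 \<le> b * k + c))"
  using assms
proof (induction I arbitrary: C rule: finite_induct)
  case empty
  show ?case
    by (rule exI[of _ "snd ` C"]) (auto simp: affine_value_def empty split: prod.splits)
next
  case (insert j I)
  define P where "P = {\<phi>\<in>C. fst \<phi> j > 0}"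
  define N where "N = {\<phi>\<in>C. fst \<phi> j < 0}"
  define Z where "Z = {\<phi>\<in>C. fst \<phi> j = 0}"
  \<comment> \<open>The multipliers \<open>- fst n j\<close> and \<open>fst p j\<close> are positive
    and cancel the coefficient of \<open>j\<close>.\<close>
  define comb where "comb = (\<lambda>(p, n). (\<lambda>i. - fst n j * fst p i + fst p j * fst n i,
    - fst n j * fst (snd p) + fst p j * fst (snd n),
    - fst n j * snd (snd p) + fst p j * snd (snd n)) :: ('i \<Rightarrow> 'f) \<times> 'f \<times> 'f)"
  define E where "E = Z \<union> comb ` (P \<times> N)"
  have fin: "finite P" "finite N" "finite E"
    using insert.prems by (auto simp: P_def N_def Z_def E_def)
  have C: "C = P \<union> N \<union> Z" by (auto simp: P_def N_def Z_def)
  have val_comb: "affine_value I y k (comb (p, n)) =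
      - fst n j * affine_value I y k p + fst p j * affine_value I y k n" for y k p n
  proof -
    have "(\<Sum>i\<in>I. (s * fst p i + t * fst n i) * y i) =
        s * (\<Sum>i\<in>I. fst p i * y i) + t * (\<Sum>i\<in>I. fst n i * y i)" for s t
      by (simp add: sum_distrib_left sum.distrib distrib_right mult.assoc)
    from this[of "- fst n j" "fst p j"] show ?thesis
      by (simp only: affine_value_def comb_def prod.case fst_conv snd_conv) (simp add: algebra_simps)
  qed
  have val_insert: "affine_value (insert j I) y k \<phi> = fst \<phi> j * y j + affine_value I y k \<phi>"
    for y :: "'i \<Rightarrow> 'f" and k \<phi>
    using insert.hyps by (simp add: affine_value_def)
  have val_upd: "affine_value I (y(j := x)) k \<phi> = affine_value I y k \<phi>" for y :: "'i \<Rightarrow> 'f" and k \<phi> x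
    unfolding affine_value_def using insert.hyps by (auto intro!: sum.cong)
  have eq: "(\<exists>y. \<forall>\<phi>\<in>C. 0 \<le> affine_value (insert j I) y k \<phi>) \<longleftrightarrow>
      (\<exists>y. \<forall>\<phi>\<in>E. 0 \<le> affine_value I y k \<phi>)" for k
  proof
    assume "\<exists>y. \<forall>\<phi>\<in>C. 0 \<le> affine_value (insert j I) y k \<phi>"
    then obtain y where y: "\<And>\<phi>. \<phi> \<in> C \<Longrightarrow> 0 \<le> fst \<phi> j * y j + affine_value I y k \<phi>"
      unfolding val_insert by blast
    have "0 \<le> affine_value I y k \<phi>" if "\<phi> \<in> E" for \<phi>
    proof (cases "\<phi> \<in> Z")
      case True
      then show ?thesis using y[of \<phi>] by (auto simp: Z_def)
    next
      case False
      then obtain p n where pn: "p \<in> P" "n \<in> N" "\<phi> = comb (p, n)"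
        using \<open>\<phi> \<in> E\<close> by (auto simp: E_def)
      have "0 \<le> - fst n j * (fst p j * y j + affine_value I y k p)"
        using pn y[of p] by (intro mult_nonneg_nonneg) (auto simp: P_def N_def)
      moreover have "0 \<le> fst p j * (fst n j * y j + affine_value I y k n)"
        using pn y[of n] by (intro mult_nonneg_nonneg) (auto simp: P_def N_def)
      ultimately show ?thesis unfolding pn(3) val_comb by (simp add: algebra_simps)
    qed
    then show "\<exists>y. \<forall>\<phi>\<in>E. 0 \<le> affine_value I y k \<phi>" by blast
  next
    assume "\<exists>y. \<forall>\<phi>\<in>E. 0 \<le> affine_value I y k \<phi>"
    then obtain y where y: "\<And>\<phi>. \<phi> \<in> E \<Longrightarrow> 0 \<le> affine_value I y k \<phi>" by blast
    \<comment> \<open>\<open>g \<phi>\<close> is the value of the variable \<open>j\<close> at which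
      \<open>\<phi>\<close> vanishes: a lower bound for \<open>\<phi>\<close> in \<open>P\<close>,
      an upper bound for \<open>\<phi>\<close> in \<open>N\<close>.\<close>
    define g where "g \<phi> = - affine_value I y k \<phi> / fst \<phi> j" for \<phi>
    have "g p \<le> g n" if "p \<in> P" "n \<in> N" for p n
    proof -
      have "0 \<le> - fst n j * affine_value I y k p + fst p j * affine_value I y k n"
        using y[of "comb (p, n)"] that unfolding val_comb E_def by auto
      then show ?thesis using that by (simp add: g_def P_def N_def field_simps)
    qed
    then have "\<exists>x. (\<forall>l\<in>g ` P. l \<le> x) \<and> (\<forall>u\<in>g ` N. x \<le> u)"
      using fin(1,2) by (intro between_finite_sets) (auto simp del: split_paired_All)
    then obtain x where x: "\<And>p. p \<in> P \<Longrightarrow> g p \<le> x" "\<And>n. n \<in> N \<Longrightarrow> x \<le> g n"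
      unfolding ball_simps(9) by blast
    have "0 \<le> affine_value (insert j I) (y(j := x)) k \<phi>" if "\<phi> \<in> C" for \<phi>
    proof -
      consider "\<phi> \<in> P" | "\<phi> \<in> N" | "\<phi> \<in> Z" using \<open>\<phi> \<in> C\<close> C by blast
      then show ?thesis
      proof cases
        case 1
        then show ?thesis using x(1)[OF 1]
          by (simp add: val_insert val_upd g_def P_def field_simps)
      next
        case 2
        then show ?thesis using x(2)[OF 2]
          by (simp add: val_insert val_upd g_def N_def field_simps)
      next
        case 3
        then show ?thesis using y[of \<phi>] by (simp add: val_insert val_upd E_def Z_def)
      qed
    qed
    then show "\<exists>y. \<forall>\<phi>\<in>C. 0 \<le> affine_value (insert j I) y k \<phi>" by blast
  qed
  show ?case unfolding eq by (rule insert.IH[OF fin(3)])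
qed

text \<open>Inequalities with \<open>b > 0\<close> bound \<open>k\<close> from below by
  \<open>- c / b\<close>. The largest of these bounds is the minimum, since all the others survive
  lowering \<open>k\<close> from the feasible \<open>k0\<close>.\<close>

lemma linear_inequalities_attain_min:
  fixes D :: "('f::linordered_field \<times> 'f) set"
  assumes "finite D"
    and k0: "\<forall>(b, c)\<in>D. 0 \<le> b * k0 + c"
    and bound: "\<And>k. \<forall>(b, c)\<in>D. 0 \<le> b * k + c \<Longrightarrow> l \<le> k"
  shows "\<exists>m. (\<forall>(b, c)\<in>D. 0 \<le> b * m + c) \<and> (\<forall>k. (\<forall>(b, c)\<in>D. 0 \<le> b * k + c) \<longrightarrow> m \<le> k)"
proof -
  define R where "R = (\<lambda>(b, c). - c / b) ` {d\<in>D. fst d > 0}"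
  have finR: "finite R" using assms(1) by (simp add: R_def)
  have R_le: "r \<le> k" if "r \<in> R" "\<forall>(b, c)\<in>D. 0 \<le> b * k + c" for r k
    using that by (auto simp: R_def field_simps)
  have "R \<noteq> {}"
  proof
    assume "R = {}"
    then have neg: "b \<le> 0" if "(b, c) \<in> D" for b c using that by (force simp: R_def)
    \<comment> \<open>Without lower bounds every point below \<open>k0\<close> is feasible, even one
      below \<open>l\<close>.\<close>
    define k where "k = min k0 (l - 1)"
    have "0 \<le> b * k + c" if "(b, c) \<in> D" for b c
    proof -
      have "b * k0 \<le> b * k" using neg[OF that] by (intro mult_left_mono_neg) (simp_all add: k_def)
      moreover have "0 \<le> b * k0 + c" using k0 that by auto
      ultimately show ?thesis by simp
    qed
    then have "l \<le> k" by (intro bound) auto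
    then show False by (simp add: k_def min_def split: if_splits)
  qed
  define m where "m = Max R"
  have "m \<in> R" using finR \<open>R \<noteq> {}\<close> by (simp add: m_def)
  have "0 \<le> b * m + c" if "(b, c) \<in> D" for b c
  proof (cases "b > 0")
    case True
    then have "- c / b \<in> R" using that by (force simp: R_def)
    then have "- c / b \<le> m" using finR by (simp add: m_def)
    then show ?thesis using True by (simp add: field_simps)
  next
    case False
    have "b * k0 \<le> b * m" using False R_le[OF \<open>m \<in> R\<close> k0] by (intro mult_left_mono_neg) auto
    moreover have "0 \<le> b * k0 + c" using k0 that by auto
    ultimately show ?thesis by simp
  qed
  then show ?thesis using R_le[OF \<open>m \<in> R\<close>] by auto
qed

section \<open>The fractional chromatic number as an attained minimum\<close>

lemma finite_stable_sets: "finite (pverts G) \<Longrightarrow> finite (stable_sets G)"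
  by (rule finite_subset[of _ "Pow (pverts G)"]) (auto simp: stable_sets_def)

text \<open>A single colouring bounds \<open>LEAST\<close> only once the minimum is known to be
  attained; this follows by eliminating all the weights \<open>y S\<close>.\<close>

lemma frac_chromatic_le:
  assumes fin: "finite (pverts G)" and col: "frac_colouring G w k0 y0"
  shows "frac_chromatic G w \<le> k0"
proof -
  let ?S = "stable_sets G"
  note finS = finite_stable_sets[OF fin]
  \<comment> \<open>The constraints are nonnegativity of each \<open>y T\<close>, total weight at
    least \<open>k\<close> and at most \<open>k\<close>, and the demand of each vertex.\<close>
  define C :: "(('a set \<Rightarrow> rat) \<times> rat \<times> rat) set" where
    "C = (\<lambda>T. (\<lambda>S. of_bool (S = T), 0, 0)) ` ?S \<union> {(\<lambda>_. 1, - 1, 0), (\<lambda>_. - 1, 1, 0)} \<union>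
      (\<lambda>v. (\<lambda>S. of_bool (v \<in> S), 0, - w v)) ` pverts G"
  have "(\<Sum>S\<in>?S. of_bool (S = T) * y S) = y T" if "T \<in> ?S" for y :: "'a set \<Rightarrow> rat" and T
    using that finS by (simp add: of_bool_def if_distrib[of "\<lambda>x. x * _"] cong: if_cong)
  moreover have "(\<Sum>S\<in>?S. of_bool (v \<in> S) * y S) = (\<Sum>S | S \<in> ?S \<and> v \<in> S. y S)"
    for y :: "'a set \<Rightarrow> rat" and v
    using finS by (simp add: of_bool_def if_distrib[of "\<lambda>x. x * _"] sum.inter_filter cong: if_cong)
  ultimately have feasible: "frac_colouring G w k y \<longleftrightarrow> (\<forall>\<phi>\<in>C. 0 \<le> affine_value ?S y k \<phi>)" for k y
    unfolding frac_colouring_def C_def ball_Un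
    by (auto simp: affine_value_def sum_negf)
  have "finite C" using finS fin by (simp add: C_def)
  from fourier_motzkin[OF finS this] obtain D where D: "finite D"
    "\<And>k. (\<exists>y. frac_colouring G w k y) \<longleftrightarrow> (\<forall>(b, c)\<in>D. 0 \<le> b * k + c)"
    unfolding feasible by blast
  have "0 \<le> k" if "frac_colouring G w k y" for k y
    using that by (auto simp: frac_colouring_def intro: sum_nonneg)
  with linear_inequalities_attain_min[OF D(1), of k0 0] col
  obtain m where "\<exists>y. frac_colouring G w m y" "\<And>k. \<exists>y. frac_colouring G w k y \<Longrightarrow> m \<le> k"
    unfolding D(2)[symmetric] by blast
  then have "frac_chromatic G w = m" unfolding frac_chromatic_def by (intro Least_equality)
  with \<open>\<And>k. \<exists>y. frac_colouring G w k y \<Longrightarrow> m \<le> k\<close> col show ?thesis by blast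
qed

section \<open>Maximum stable sets and the local inequality\<close>

text \<open>Maximum in cardinality, not merely under inclusion: an exchange of elements preserves
  the cardinality and hence membership.\<close>

definition maximum_stable_sets :: "'a pair_pre_digraph \<Rightarrow> 'a set \<Rightarrow> 'a set set" where
  "maximum_stable_sets G H =
    {S \<in> stable_sets G. S \<subseteq> H \<and> (\<forall>T\<in>stable_sets G. T \<subseteq> H \<longrightarrow> card T \<le> card S)}"

context pair_graph
begin

lemma arc_commute: "(u, v) \<in> parcs G \<longleftrightarrow> (v, u) \<in> parcs G"
  using arcs_symmetric by blast

lemma not_arc_self: "(v, v) \<notin> parcs G"
  using pair_no_loops[of "(v, v)"] by auto

lemma closed_nbhd_subset: "v \<in> pverts G \<Longrightarrow> closed_nbhd G v \<subseteq> pverts G"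
  using in_arcsD2 by (auto simp: closed_nbhd_def)

lemma clique_weight_ge:
  assumes "C \<in> cliques G" "v \<in> C"
  shows "sum w C \<le> clique_weight G w v"
proof -
  have "finite (cliques G)"
    by (rule finite_subset[of _ "Pow (pverts G)"]) (auto simp: cliques_def)
  then show ?thesis unfolding clique_weight_def using assms by (intro Max_ge) auto
qed

lemma finite_maximum_stable_sets: "finite (maximum_stable_sets G H)"
  using finite_stable_sets[OF pair_finite_verts] by (simp add: maximum_stable_sets_def)

lemma maximum_stable_sets_nonempty:
  assumes "H \<subseteq> pverts G"
  shows "maximum_stable_sets G H \<noteq> {}"
proof -
  let ?A = "{S \<in> stable_sets G. S \<subseteq> H}"
  have "finite ?A" "{} \<in> ?A" using finite_stable_sets[OF pair_finite_verts] by (auto simp: stable_sets_def)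
  then have "Max (card ` ?A) \<in> card ` ?A" by (intro Max_in) auto
  then obtain S where "S \<in> ?A" "card S = Max (card ` ?A)" by auto
  then have "S \<in> maximum_stable_sets G H"
    using \<open>finite ?A\<close> by (auto simp: maximum_stable_sets_def intro!: Max_ge)
  then show ?thesis by blast
qed

text \<open>Otherwise \<open>v\<close> could be added to \<open>S\<close>.\<close>

lemma maximum_stable_set_meets_nbhd:
  assumes "H \<subseteq> pverts G" "v \<in> H" "S \<in> maximum_stable_sets G H"
  shows "S \<inter> closed_nbhd G v \<noteq> {}"
proof
  assume "S \<inter> closed_nbhd G v = {}"
  with assms have "insert v S \<in> stable_sets G" "v \<notin> S" "insert v S \<subseteq> H"
    by (auto simp: maximum_stable_sets_def stable_sets_def closed_nbhd_def not_arc_self arc_commute)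
  moreover from this have "finite S" using assms(1) finite_subset[of S "pverts G"] by auto
  ultimately show False using assms(3) by (force simp: maximum_stable_sets_def)
qed

text \<open>
  Exchanging the unique element of \<open>S\<close> in the closed neighbourhood of \<open>v\<close> for \<open>v\<close> itself maps
  these sets \<open>S\<close> to maximum stable sets \<open>T\<close> containing \<open>v\<close>; the elements \<open>u\<close> that get exchanged
  for \<open>v\<close> over a fixed \<open>T\<close> are pairwise adjacent, because \<open>T\<close> cannot be enlarged.
\<close>

lemma exchange_weight_le:
  fixes w :: "'a \<Rightarrow> rat"
  assumes H: "H \<subseteq> pverts G" and v: "v \<in> H" and w: "\<And>u. u \<in> H \<Longrightarrow> 0 < w u"
  defines "M \<equiv> maximum_stable_sets G H" and "B \<equiv> closed_nbhd G v"
  shows "(\<Sum>S | S \<in> M \<and> card (S \<inter> B) = 1. prod w S)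
    \<le> clique_weight G w v / w v * (\<Sum>T | T \<in> M \<and> v \<in> T. prod w T)"
proof -
  let ?M1 = "{S. S \<in> M \<and> card (S \<inter> B) = 1}" and ?Mv = "{T. T \<in> M \<and> v \<in> T}"
  \<comment> \<open>The unique element of \<open>S\<close> in \<open>B\<close> may be
    \<open>v\<close> itself; then \<open>f S = S\<close>.\<close>
  define f where "f S = insert v (S - B)" for S
  have finM: "finite M" unfolding M_def by (rule finite_maximum_stable_sets)
  have vB: "v \<in> B" by (simp add: B_def closed_nbhd_def)
  have stab: "S \<in> stable_sets G" "S \<subseteq> H" "finite S" if "S \<in> M" for S
    using that H finite_subset[of S "pverts G"] by (auto simp: M_def maximum_stable_sets_def)
  have maxc: "card T \<le> card S" if "S \<in> M" "T \<in> stable_sets G" "T \<subseteq> H" for S T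
    using that by (auto simp: M_def maximum_stable_sets_def)
  have TB: "T \<inter> B = {v}" if "T \<in> ?Mv" for T
    using that stab[of T] by (auto simp: B_def closed_nbhd_def stable_sets_def)
  have f_in: "f S \<in> ?Mv" if "S \<in> ?M1" for S
  proof -
    have "f S \<in> stable_sets G"
      using that stab[of S] H v
      by (auto simp: f_def stable_sets_def B_def closed_nbhd_def not_arc_self arc_commute)
    moreover have "card (f S) = card S"
    proof -
      have "finite S" using that stab by auto
      have "card (f S) = Suc (card (S - B))" using vB \<open>finite S\<close> by (simp add: f_def)
      also have "\<dots> = card (S - B) + card (S \<inter> B)" using that by simp
      also have "\<dots> = card S" using card_Int_Diff[OF \<open>finite S\<close>, of B] by simp
      finally show ?thesis .
    qed
    moreover have "f S \<subseteq> H" using that stab[of S] v by (auto simp: f_def)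
    ultimately show ?thesis using that by (auto simp: M_def maximum_stable_sets_def f_def)
  qed
  have fibre: "(\<Sum>S | S \<in> ?M1 \<and> f S = T. prod w S) \<le> clique_weight G w v / w v * prod w T"
    if T: "T \<in> ?Mv" for T
  proof -
    let ?ex = "\<lambda>u. insert u (T - {v})"
    define U where "U = {u \<in> B. ?ex u \<in> M}"
    have "w v > 0" using w v by simp
    have T': "finite T" "T \<subseteq> H" "v \<in> T" "T \<in> M" "T \<in> stable_sets G" using T stab by auto
    have U_H: "U \<subseteq> H" using stab by (auto simp: U_def)
    have U_T: "u \<notin> T - {v}" if "u \<in> U" for u using that TB[OF T] by (auto simp: U_def)
    have "v \<in> U" using T' vB by (simp add: U_def insert_absorb)
    have adj: "(a, b) \<in> parcs G" if "a \<in> U" "b \<in> U" "a \<noteq> b" for a b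
    proof (rule ccontr)
      assume na: "(a, b) \<notin> parcs G"
      \<comment> \<open>For nonadjacent \<open>a\<close> and \<open>b\<close> this set would be
        stable and one element larger than \<open>T\<close>.\<close>
      let ?X = "insert a (insert b (T - {v}))"
      have "?ex a \<in> stable_sets G" "?ex b \<in> stable_sets G" using that stab by (auto simp: U_def)
      then have "?X \<in> stable_sets G" using na by (auto simp: stable_sets_def arc_commute)
      moreover have "?X \<subseteq> H" using U_H that T' by auto
      ultimately have "card ?X \<le> card T" using maxc T' by blast
      moreover have "card ?X = Suc (Suc (card (T - {v})))"
        using U_T[OF that(1)] U_T[OF that(2)] that(3) T'(1) by simp
      moreover have "Suc (card (T - {v})) = card T" using T' by (metis card.remove)
      ultimately show False by simp
    qed
    have sub: "{S. S \<in> ?M1 \<and> f S = T} \<subseteq> ?ex ` U"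
    proof
      fix S assume S: "S \<in> {S. S \<in> ?M1 \<and> f S = T}"
      then obtain u where u: "S \<inter> B = {u}" by (auto simp: card_1_singleton_iff)
      have "T - {v} = S - B" using S vB by (auto simp: f_def)
      then have "S = ?ex u" using u by auto
      then show "S \<in> ?ex ` U" using S u by (auto simp: U_def)
    qed
    have inj: "inj_on ?ex U" using U_T by (force simp: inj_on_def)
    \<comment> \<open>With product weights an exchange multiplies the weight by
      \<open>w u / w v\<close>, so that summing over the clique \<open>U\<close> produces the clique
      weight.\<close>
    have prod_ex: "prod w (?ex u) = prod w T / w v * w u" if "u \<in> U" for u
    proof -
      have "prod w T = w v * prod w (T - {v})" using T' by (simp add: prod.remove)
      then show ?thesis using U_T[OF that] T' \<open>w v > 0\<close> by simp
    qed
    have nonneg: "0 \<le> prod w S" if "S \<subseteq> H" for S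
      using w that by (intro prod_nonneg) (auto intro: less_imp_le)
    have "finite U" using U_H H finite_subset[of U "pverts G"] by auto
    have "(\<Sum>S | S \<in> ?M1 \<and> f S = T. prod w S) \<le> (\<Sum>S\<in>?ex ` U. prod w S)"
      using sub \<open>finite U\<close> stab by (intro sum_mono2 nonneg) (auto simp: U_def)
    also have "\<dots> = (\<Sum>u\<in>U. prod w T / w v * w u)"
      using prod_ex by (simp add: sum.reindex[OF inj])
    also have "\<dots> = prod w T / w v * sum w U" by (simp add: sum_distrib_left)
    also have "\<dots> \<le> prod w T / w v * clique_weight G w v"
    proof (intro mult_left_mono clique_weight_ge)
      show "U \<in> cliques G" using adj U_H H by (auto simp: cliques_def)
      show "0 \<le> prod w T / w v" using nonneg[OF T'(2)] \<open>w v > 0\<close> by simp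
    qed fact
    finally show ?thesis by (simp add: field_simps)
  qed
  have "(\<Sum>S\<in>?M1. prod w S) = (\<Sum>T\<in>?Mv. \<Sum>S | S \<in> ?M1 \<and> f S = T. prod w S)"
    using finM f_in by (intro sum.group[symmetric]) auto
  also have "\<dots> \<le> (\<Sum>T\<in>?Mv. clique_weight G w v / w v * prod w T)"
    by (intro sum_mono fibre)
  finally show ?thesis by (simp add: sum_distrib_left)
qed

text \<open>This is the inequality between expectations multiplied by the total weight of
  \<open>M\<close>, which avoids normalising the distribution.\<close>

lemma local_reed_inequality:
  fixes w :: "'a \<Rightarrow> rat"
  assumes H: "H \<subseteq> pverts G" and v: "v \<in> H" and w: "\<And>u. u \<in> H \<Longrightarrow> 0 < w u"
  defines "M \<equiv> maximum_stable_sets G H"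
  shows "2 * (\<Sum>S\<in>M. prod w S) \<le>
    (\<Sum>u\<in>closed_nbhd G v. \<Sum>S | S \<in> M \<and> u \<in> S. prod w S) +
    clique_weight G w v / w v * (\<Sum>S | S \<in> M \<and> v \<in> S. prod w S)"
proof -
  let ?B = "closed_nbhd G v"
  have finM: "finite M" unfolding M_def by (rule finite_maximum_stable_sets)
  have finB: "finite ?B" using closed_nbhd_subset[of v] v H
    by (intro finite_subset[OF _ pair_finite_verts]) auto
  have pos: "0 \<le> prod w S" if "S \<in> M" for S
  proof (rule prod_nonneg)
    fix u assume "u \<in> S"
    with that have "u \<in> H" by (auto simp: M_def maximum_stable_sets_def)
    then show "0 \<le> w u" using w by (simp add: less_imp_le)
  qed
  have "2 * (\<Sum>S\<in>M. prod w S) \<le>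
    (\<Sum>S\<in>M. of_nat (card (S \<inter> ?B)) * prod w S + of_bool (card (S \<inter> ?B) = 1) * prod w S)"
    unfolding sum_distrib_left
  proof (rule sum_mono)
    fix S assume S: "S \<in> M"
    have "card (S \<inter> ?B) \<noteq> 0"
      using maximum_stable_set_meets_nbhd[OF H v S[unfolded M_def]] finB by simp
    \<comment> \<open>The intersection is nonempty, and the indicator supplies the missing unit
      exactly when it has one element.\<close>
    then have "2 \<le> card (S \<inter> ?B) + of_bool (card (S \<inter> ?B) = 1)" by (auto simp: of_bool_def)
    then have "(of_nat 2 :: rat) \<le> of_nat (card (S \<inter> ?B) + of_bool (card (S \<inter> ?B) = 1))"
      by (rule of_nat_mono)
    then have "(2::rat) \<le> of_nat (card (S \<inter> ?B)) + of_bool (card (S \<inter> ?B) = 1)" by simp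
    from mult_right_mono[OF this pos[OF S]]
    show "2 * prod w S \<le> of_nat (card (S \<inter> ?B)) * prod w S + of_bool (card (S \<inter> ?B) = 1) * prod w S"
      by (simp add: algebra_simps)
  qed
  also have "\<dots> = (\<Sum>S\<in>M. of_nat (card (S \<inter> ?B)) * prod w S) +
      (\<Sum>S | S \<in> M \<and> card (S \<inter> ?B) = 1. prod w S)"
    using finM by (simp add: sum.distrib of_bool_def if_distrib[of "\<lambda>x. x * _"] sum.inter_filter
        cong: if_cong)
  also have "(\<Sum>S\<in>M. of_nat (card (S \<inter> ?B)) * prod w S) =
      (\<Sum>S\<in>M. \<Sum>u | u \<in> ?B \<and> u \<in> S. prod w S)"
    by (simp add: Int_def conj_commute)
  also have "\<dots> = (\<Sum>u\<in>?B. \<Sum>S | S \<in> M \<and> u \<in> S. prod w S)"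
    using finM finB by (rule sum.swap_restrict)
  finally show ?thesis
    using exchange_weight_le[OF H v, of w, OF w] by (simp add: M_def)
qed

section \<open>Covering the demand step by step\<close>

text \<open>
  The residual demand \<open>r\<close> changes along the induction, while \<open>w\<close> stays fixed; at the start \<open>r = w\<close>.
\<close>

lemma fractional_cover:
  fixes w r :: "'a \<Rightarrow> rat"
  assumes "\<forall>u\<in>pverts G. 0 \<le> r u" "\<forall>u\<in>pverts G. 0 < r u \<longrightarrow> 0 < w u" "\<exists>u\<in>pverts G. 0 < r u"
  shows "\<exists>y. \<exists>v\<in>pverts G. 0 < r v \<and> (\<forall>S\<in>stable_sets G. 0 \<le> y S) \<and>
    (\<forall>u\<in>pverts G. r u \<le> (\<Sum>S | S \<in> stable_sets G \<and> u \<in> S. y S)) \<and>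
    2 * (\<Sum>S\<in>stable_sets G. y S) \<le>
      (\<Sum>u\<in>closed_nbhd G v. r u) + clique_weight G w v / w v * r v"
  using assms
proof (induction "card {u \<in> pverts G. 0 < r u}" arbitrary: r rule: less_induct)
  case less
  define H where "H = {u \<in> pverts G. 0 < r u}"
  define M where "M = maximum_stable_sets G H"
  define q where "q u = (\<Sum>S | S \<in> M \<and> u \<in> S. prod w S)" for u
  define Z where "Z = (\<Sum>S\<in>M. prod w S)"
  have HV: "H \<subseteq> pverts G" and wH: "\<And>u. u \<in> H \<Longrightarrow> 0 < w u" and rH: "\<And>u. u \<in> H \<Longrightarrow> 0 < r u"
    using less.prems by (auto simp: H_def)
  have finH: "finite H" by (simp add: H_def)
  have finS: "finite (stable_sets G)" using finite_stable_sets[OF pair_finite_verts] .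
  have finM: "finite M" unfolding M_def by (rule finite_maximum_stable_sets)
  have M_sub: "M \<subseteq> stable_sets G" "\<And>S. S \<in> M \<Longrightarrow> S \<subseteq> H"
    by (auto simp: M_def maximum_stable_sets_def)
  have wt: "0 < prod w S" if "S \<in> M" for S using M_sub(2)[OF that] wH by (intro prod_pos) auto
  have q_nonneg: "0 \<le> q u" for u unfolding q_def using wt by (intro sum_nonneg) (auto intro: less_imp_le)
  have q_out: "q u = 0" if "u \<notin> H" for u
    using that M_sub(2) unfolding q_def by (intro sum.neutral) auto
  obtain v0 where v0: "v0 \<in> H" using less.prems(3) by (auto simp: H_def)
  obtain S0 where S0: "S0 \<in> M" using maximum_stable_sets_nonempty[OF HV] by (auto simp: M_def)
  \<comment> \<open>A vertex with \<open>q u1 > 0\<close> makes \<open>Q\<close> nonempty, so that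
    the minimum \<open>t\<close> exists.\<close>
  obtain u1 where u1: "u1 \<in> S0"
    using maximum_stable_set_meets_nbhd[OF HV v0] S0 by (auto simp: M_def)
  have "0 < q u1" unfolding q_def using finM S0 u1 wt by (intro sum_pos) auto
  define Q where "Q = {u \<in> H. 0 < q u}"
  have Q: "finite Q" "u1 \<in> Q" using finH \<open>0 < q u1\<close> q_out[of u1] by (auto simp: Q_def)
  \<comment> \<open>The largest multiple of the distribution that keeps every residual demand
    nonnegative; the demand of a minimiser drops to 0.\<close>
  define t where "t = Min ((\<lambda>u. r u / q u) ` Q)"
  have "t \<in> (\<lambda>u. r u / q u) ` Q" unfolding t_def using Q by (intro Min_in) auto
  then obtain u0 where u0: "u0 \<in> Q" "t = r u0 / q u0" by auto
  have "0 < t" using u0 rH by (auto simp: Q_def)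
  define r' where "r' u = r u - t * q u" for u
  have r'_nonneg: "0 \<le> r' u" if "u \<in> pverts G" for u
  proof (cases "u \<in> Q")
    case True
    then have "t \<le> r u / q u" unfolding t_def using Q by (intro Min_le) auto
    then show ?thesis using True by (simp add: r'_def Q_def field_simps)
  next
    case False
    then have "q u = 0" using q_out[of u] q_nonneg[of u] by (auto simp: Q_def)
    then show ?thesis using less.prems(1) that by (simp add: r'_def)
  qed
  have r'_le: "r' u \<le> r u" for u using \<open>0 < t\<close> q_nonneg[of u] by (simp add: r'_def)
  have "r' u0 = 0" using u0 by (simp add: r'_def Q_def)
  then have "u0 \<in> H" "u0 \<notin> {u \<in> pverts G. 0 < r' u}" using u0 by (auto simp: Q_def)
  moreover have "{u \<in> pverts G. 0 < r' u} \<subseteq> H"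
    using r'_le by (force simp: H_def intro: less_le_trans)
  ultimately have smaller: "card {u \<in> pverts G. 0 < r' u} < card {u \<in> pverts G. 0 < r u}"
    using finH unfolding H_def by (intro psubset_card_mono) auto
  \<comment> \<open>The vertex \<open>v\<close> obtained for \<open>r'\<close> has
    \<open>0 < r' v\<close>, hence lies in \<open>H\<close>, where the local inequality holds. If no
    demand is left, zero weights and \<open>v0\<close> serve.\<close>
  obtain y' v where y': "v \<in> H" "\<forall>S\<in>stable_sets G. 0 \<le> y' S"
    "\<forall>u\<in>pverts G. r' u \<le> (\<Sum>S | S \<in> stable_sets G \<and> u \<in> S. y' S)"
    "2 * (\<Sum>S\<in>stable_sets G. y' S) \<le>
      (\<Sum>u\<in>closed_nbhd G v. r' u) + clique_weight G w v / w v * r' v"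
  proof (cases "\<exists>u\<in>pverts G. 0 < r' u")
    case True
    have "\<forall>u\<in>pverts G. 0 < r' u \<longrightarrow> 0 < w u" using less.prems(2) r'_le by (meson less_le_trans)
    from less.hyps[OF smaller _ this True] r'_nonneg r'_le that show ?thesis
      unfolding H_def by (smt (verit, del_insts) less_le_trans mem_Collect_eq)
  next
    case False
    then have zero: "r' u = 0" if "u \<in> pverts G" for u using r'_nonneg[OF that] that by force
    then have "r' v0 = 0" "(\<Sum>u\<in>closed_nbhd G v0. r' u) = 0"
      using v0 HV closed_nbhd_subset[of v0] by (auto intro!: sum.neutral)
    then show ?thesis using zero v0 by (intro that[of v0 "\<lambda>_. 0"]) auto
  qed
  define g where "g S = (if S \<in> M then prod w S else 0)" for S
  have g_nonneg: "0 \<le> g S" for S using wt by (auto simp: g_def intro: less_imp_le)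
  have g_Z: "(\<Sum>S\<in>stable_sets G. g S) = Z" unfolding Z_def g_def
    using finS M_sub(1) by (intro sum.mono_neutral_cong_right) auto
  have g_q: "(\<Sum>S | S \<in> stable_sets G \<and> u \<in> S. g S) = q u" for u unfolding q_def g_def
    using finS M_sub(1) by (intro sum.mono_neutral_cong_right) auto
  define y where "y S = y' S + t * g S" for S
  have "v \<in> pverts G" "0 < r v" using y'(1) by (auto simp: H_def)
  moreover have "\<forall>S\<in>stable_sets G. 0 \<le> y S" using y'(2) \<open>0 < t\<close> g_nonneg by (simp add: y_def)
  moreover have "\<forall>u\<in>pverts G. r u \<le> (\<Sum>S | S \<in> stable_sets G \<and> u \<in> S. y S)"
    using y'(3) by (auto simp: y_def sum.distrib sum_distrib_left[symmetric] g_q r'_def)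
  moreover have "2 * (\<Sum>S\<in>stable_sets G. y S) \<le>
      (\<Sum>u\<in>closed_nbhd G v. r u) + clique_weight G w v / w v * r v"
  proof -
    \<comment> \<open>\<open>c\<close> depends on the fixed \<open>w\<close> and not on the residual
      demand, so the bound for \<open>r'\<close> and the bound for this step can be added.\<close>
    define c where "c = clique_weight G w v / w v"
    have "t * (2 * Z) \<le> t * ((\<Sum>u\<in>closed_nbhd G v. q u) + c * q v)"
      using local_reed_inequality[OF HV y'(1), of w, OF wH] \<open>0 < t\<close>
      by (intro mult_left_mono) (auto simp: Z_def q_def M_def c_def)
    with y'(4)[folded c_def] show ?thesis
      unfolding c_def[symmetric]
      by (simp add: y_def r'_def sum.distrib sum_subtractf sum_distrib_left[symmetric] g_Z algebra_simps)
  qed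
  ultimately show ?case by blast
qed

section \<open>Comparison with the Reed weight\<close>

lemma reed_weight_at_nonneg:
  assumes w: "\<forall>u\<in>pverts G. 0 \<le> w u" and v: "v \<in> pverts G"
  shows "0 \<le> reed_weight_at G w v"
proof -
  have "0 \<le> degree_weight G w v"
    unfolding degree_weight_def using w closed_nbhd_subset[OF v] by (intro sum_nonneg) auto
  moreover have "w v \<le> clique_weight G w v"
    using clique_weight_ge[of "{v}" v w] v by (simp add: cliques_def)
  ultimately show ?thesis using w v by (auto simp: reed_weight_at_def)
qed

lemma reed_weight_at_le: "v \<in> pverts G \<Longrightarrow> reed_weight_at G w v \<le> reed_weight G w"
  by (auto simp: reed_weight_def)

end

theorem theorem4:
  fixes G :: "'a pair_pre_digraph" and w :: "'a \<Rightarrow> rat"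
  assumes "pair_graph G"
    and "\<forall>v\<in>pverts G. 0 \<le> w v"
  shows "frac_chromatic G w \<le> reed_weight G w"
proof -
  interpret pair_graph G by fact
  show ?thesis
  proof (cases "\<exists>u\<in>pverts G. 0 < w u")
    case True
    from fractional_cover[OF assms(2) _ this] obtain y v where
      y: "v \<in> pverts G" "0 < w v" "\<forall>S\<in>stable_sets G. 0 \<le> y S"
        "\<forall>u\<in>pverts G. w u \<le> (\<Sum>S | S \<in> stable_sets G \<and> u \<in> S. y S)"
        "2 * (\<Sum>S\<in>stable_sets G. y S) \<le>
          (\<Sum>u\<in>closed_nbhd G v. w u) + clique_weight G w v / w v * w v"
      by blast
    have "frac_chromatic G w \<le> (\<Sum>S\<in>stable_sets G. y S)"
      using y by (intro frac_chromatic_le) (auto simp: frac_colouring_def)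
    \<comment> \<open>At the initial demand \<open>r = w\<close> the factor \<open>w v\<close>
      cancels and leaves the clique weight.\<close>
    also have "\<dots> \<le> reed_weight_at G w v"
      using y by (simp add: reed_weight_at_def degree_weight_def)
    also have "\<dots> \<le> reed_weight G w" using y(1) by (rule reed_weight_at_le)
    finally show ?thesis .
  next
    case False
    \<comment> \<open>All weights vanish here, so the zero colouring works and only nonnegativity of
      the Reed weight remains.\<close>
    then have "frac_colouring G w 0 (\<lambda>_. 0)" by (auto simp: frac_colouring_def not_less)
    then have "frac_chromatic G w \<le> 0" by (intro frac_chromatic_le) auto
    also have "0 \<le> reed_weight G w"
    proof (cases "pverts G = {}")
      case False
      then obtain v where "v \<in> pverts G" by blast
      with reed_weight_at_nonneg[OF assms(2)] reed_weight_at_le show ?thesis by (meson order_trans)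
    qed (simp add: reed_weight_def)
    finally show ?thesis .
  qed
qed

end
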